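(* Let $\alpha>0$ and $\beta>0$ be real numbers, let $$\mathcal{F}(\tilde T)=\ln\beta+\ln\tilde T+\ln(1-\alpha\tilde T)+\tilde T,\qquad \tilde T\in(0,1/\alpha),$$ and let $$\tilde T_m=\frac{1}{2\alpha}-1+\sqrt{\frac{1}{4\alpha^2}+1}.$$ Then the maximum value of $\mathcal{F}$ on $(0,1/\alpha)$ is $$\mathcal{F}(\tilde T_m)=\ln\beta-\ln\left(\left(\frac{2}{\tilde T_m}+1\right)e^{-\tilde T_m}\right).$$ Hence the equation $\beta\tilde T(1-\alpha\tilde T)=e^{-\tilde T}$ in the unknown $\tilde T\in(0,\infty)$ has two solutions (fixed points), which coincide exactly when $\mathcal{F}(\tilde T_m)=0$, if and only if $$\beta\ge\left(\frac{2}{\tilde T_m}+1\right)e^{-\tilde T_m}.$$ Otherwise the equation has no solution.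
   Context: Solutions $\tilde T\in(0,\infty)$ of $\beta\tilde T(1-\alpha\tilde T)=e^{-\tilde T}$ are called fixed points. "Two fixed points" is counted so that the equality case $\beta=\left(\frac{2}{\tilde T_m}+1\right)e^{-\tilde T_m}$ corresponds to two coinciding solutions (a single double point), and the strict inequality corresponds to two distinct solutions. *)

theory Defs
  imports "HOL-Analysis.Analysis" "HOL-Library.Multiset"
begin

definition calF :: "real \<Rightarrow> real \<Rightarrow> real \<Rightarrow> real" where
  "calF \<alpha> \<beta> T = ln \<beta> + ln T + ln (1 - \<alpha> * T) + T"

definition T_m :: "real \<Rightarrow> real" where
  "T_m \<alpha> = 1 / (2 * \<alpha>) - 1 + sqrt (1 / (4 * \<alpha>\<^sup>2) + 1)"

definition fixed_points :: "real \<Rightarrow> real \<Rightarrow> real set" where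
  "fixed_points \<alpha> \<beta> = {T. 0 < T \<and> \<beta> * T * (1 - \<alpha> * T) = exp (- T)}"

text \<open>Order of vanishing, for smooth \<open>f\<close>: the total function \<^const>\<open>deriv\<close> carries no
  information where the derivative does not exist.\<close>

definition has_zero_of_order :: "(real \<Rightarrow> real) \<Rightarrow> real \<Rightarrow> nat \<Rightarrow> bool" where
  "has_zero_of_order f x n \<longleftrightarrow>
     (\<forall>k<n. (deriv ^^ k) f x = 0) \<and> (deriv ^^ n) f x \<noteq> 0"

text \<open>\<open>T1\<close> and \<open>T2\<close> are all the fixed points, counted with multiplicity: either two distinct
  simple solutions, or (\<open>T1 = T2\<close>) a single solution that is a genuine double zero.\<close>

definition two_fixed_points :: "real \<Rightarrow> real \<Rightarrow> real \<Rightarrow> real \<Rightarrow> bool" where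
  "two_fixed_points \<alpha> \<beta> T1 T2 \<longleftrightarrow>
     fixed_points \<alpha> \<beta> = {T1, T2} \<and>
     (\<forall>T \<in> fixed_points \<alpha> \<beta>.
        has_zero_of_order (\<lambda>t. \<beta> * t * (1 - \<alpha> * t) - exp (- t)) T (count {#T1, T2#} T))"

end

theory Submission imports Defs begin

text \<open>The equation is equivalent to \<open>\<beta> g(T) = 1\<close> with \<open>g(T) = T (1 - \<alpha> T) e\<^sup>T\<close>, and
  \<open>F = ln (\<beta> g)\<close> on \<open>(0, 1/\<alpha>)\<close>. Here \<open>g' = q e\<^sup>T\<close> for the quadratic
  \<open>q(T) = 1 + (1 - 2\<alpha>) T - \<alpha> T\<^sup>2\<close>, whose positive root is \<open>T\<^sub>m\<close>; so \<open>g\<close> increases strictly from \<open>0\<close>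
  up to \<open>T\<^sub>m\<close> and decreases strictly afterwards, which counts the solutions. At a
  solution, the derivative of \<open>\<beta> T (1 - \<alpha> T) - e\<^sup>-\<^sup>T\<close> equals \<open>\<beta> q(T)\<close>, and the second derivative
  is negative everywhere; so a zero is double if it equals \<open>T\<^sub>m\<close> and simple otherwise.\<close>

definition gain :: "real \<Rightarrow> real \<Rightarrow> real" where
  "gain \<alpha> t = t * (1 - \<alpha> * t) * exp t"

definition crit_poly :: "real \<Rightarrow> real \<Rightarrow> real" where
  "crit_poly \<alpha> t = 1 + (1 - 2 * \<alpha>) * t - \<alpha> * t\<^sup>2"

section \<open>The critical point \<open>T_m\<close> and the sign of
  \<open>crit_poly\<close>\<close>

lemma crit_poly_T_m:
  assumes "\<alpha> > 0"
  shows "crit_poly \<alpha> (T_m \<alpha>) = 0"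
proof -
  define s where "s = sqrt (1 / (4 * \<alpha>\<^sup>2) + 1)"
  have s2: "s\<^sup>2 = 1 / (4 * \<alpha>\<^sup>2) + 1"
    unfolding s_def by (simp add: add_nonneg_nonneg)
  have Tm: "T_m \<alpha> = 1 / (2 * \<alpha>) - 1 + s"
    by (simp add: T_m_def s_def)
  \<comment> \<open>Completing the square: \<open>crit_poly \<alpha> t\<close> is
    \<open>\<alpha> + 1 / (4 * \<alpha>)\<close> minus \<open>\<alpha>\<close> times the square of
    \<open>t + 1 - 1 / (2 * \<alpha>)\<close>, and that last term equals \<open>s\<close> at
    \<open>T_m\<close>.\<close>
  have "crit_poly \<alpha> (T_m \<alpha>) = \<alpha> + 1 / (4 * \<alpha>) - \<alpha> * s\<^sup>2"
    unfolding crit_poly_def Tm using assms by (simp add: field_simps power2_eq_square)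
  also have "\<dots> = 0"
    unfolding s2 using assms by (simp add: field_simps power2_eq_square)
  finally show ?thesis .
qed

lemma T_m_pos:
  assumes "\<alpha> > 0"
  shows "T_m \<alpha> > 0"
proof -
  have "sqrt (1 / (4 * \<alpha>\<^sup>2) + 1) > 1" "1 / (2 * \<alpha>) > 0"
    using assms by simp_all
  then show ?thesis
    unfolding T_m_def by linarith
qed

text \<open>Immediate from \<open>crit_poly \<alpha> t = (1 - \<alpha> * t) * (t + 2) - 1\<close>.
  It removes \<open>\<alpha>\<close> from the maximal value and places \<open>T_m\<close> below
  \<open>1 / \<alpha>\<close>.\<close>

lemma one_minus_mult_T_m:
  assumes "\<alpha> > 0"
  shows "1 - \<alpha> * T_m \<alpha> = 1 / (T_m \<alpha> + 2)"
  using crit_poly_T_m[OF assms] T_m_pos[OF assms]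
  by (simp add: crit_poly_def field_simps power2_eq_square)

lemma T_m_less_inverse:
  assumes "\<alpha> > 0"
  shows "T_m \<alpha> < 1 / \<alpha>"
proof -
  have "1 - \<alpha> * T_m \<alpha> > 0"
    using one_minus_mult_T_m[OF assms] T_m_pos[OF assms] by simp
  then show ?thesis
    using assms by (simp add: field_simps)
qed

text \<open>By Vieta the roots have product \<open>- 1 / \<alpha>\<close>, so the root other than
  \<open>T_m\<close> is negative and the second factor is positive for
  \<open>t \<ge> 0\<close>.\<close>

lemma crit_poly_factor:
  assumes "\<alpha> > 0"
  shows "crit_poly \<alpha> t = (T_m \<alpha> - t) * (\<alpha> * t + 1 / T_m \<alpha>)"
proof -
  have inv: "1 / T_m \<alpha> = \<alpha> * T_m \<alpha> - (1 - 2 * \<alpha>)"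
    using crit_poly_T_m[OF assms] T_m_pos[OF assms]
    by (simp add: crit_poly_def field_simps power2_eq_square)
  have "(T_m \<alpha> - t) * (\<alpha> * t + 1 / T_m \<alpha>)
      = 1 + \<alpha> * t * T_m \<alpha> - \<alpha> * t\<^sup>2 - t * (1 / T_m \<alpha>)"
    using T_m_pos[OF assms] by (simp add: field_simps power2_eq_square)
  also have "\<dots> = crit_poly \<alpha> t"
    unfolding inv by (simp add: crit_poly_def algebra_simps)
  finally show ?thesis
    by simp
qed

lemma crit_poly_sign:
  assumes "\<alpha> > 0" "t \<ge> 0"
  shows "crit_poly \<alpha> t > 0 \<longleftrightarrow> t < T_m \<alpha>"
    and "crit_poly \<alpha> t < 0 \<longleftrightarrow> T_m \<alpha> < t"
    and "crit_poly \<alpha> t = 0 \<longleftrightarrow> t = T_m \<alpha>"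
proof -
  have "\<alpha> * t + 1 / T_m \<alpha> > 0"
    using assms T_m_pos[OF assms(1)] by (simp add: add_nonneg_pos)
  then show "crit_poly \<alpha> t > 0 \<longleftrightarrow> t < T_m \<alpha>"
    and "crit_poly \<alpha> t < 0 \<longleftrightarrow> T_m \<alpha> < t"
    and "crit_poly \<alpha> t = 0 \<longleftrightarrow> t = T_m \<alpha>"
    unfolding crit_poly_factor[OF assms(1)]
    by (auto simp: zero_less_mult_iff mult_less_0_iff)
qed

section \<open>Monotonicity and maximum of \<open>gain\<close>\<close>

lemma gain_has_real_derivative:
  "(gain \<alpha> has_real_derivative crit_poly \<alpha> t * exp t) (at t)"
  unfolding gain_def[abs_def] crit_poly_def
  by (auto intro!: derivative_eq_intros simp: algebra_simps power2_eq_square)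

lemma continuous_on_gain: "continuous_on S (gain \<alpha>)"
  unfolding gain_def[abs_def] by (intro continuous_intros)

lemma gain_strict_increasing:
  assumes "\<alpha> > 0" "0 \<le> s" "s < t" "t \<le> T_m \<alpha>"
  shows "gain \<alpha> s < gain \<alpha> t"
\<comment> \<open>The sign of the derivative is required only strictly between \<open>s\<close> and
  \<open>t\<close>, so \<open>t = T_m\<close>, where it vanishes, is allowed.\<close>
proof (rule DERIV_pos_imp_increasing_open[OF \<open>s < t\<close> _ continuous_on_gain])
  fix x assume "s < x" "x < t"
  then have "crit_poly \<alpha> x > 0"
    using assms crit_poly_sign(1)[of \<alpha> x] by simp
  then show "\<exists>y. (gain \<alpha> has_real_derivative y) (at x) \<and> y > 0"
    by (intro exI[of _ "crit_poly \<alpha> x * exp x"] conjI gain_has_real_derivative mult_pos_pos) auto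
qed

text \<open>The range of \<open>t\<close> extends past \<open>1 / \<alpha>\<close>, so solutions on
  the whole half-line are controlled.\<close>

lemma gain_strict_decreasing:
  assumes "\<alpha> > 0" "T_m \<alpha> \<le> s" "s < t"
  shows "gain \<alpha> t < gain \<alpha> s"
proof (rule DERIV_neg_imp_decreasing_open[OF \<open>s < t\<close> _ continuous_on_gain])
  fix x assume "s < x" "x < t"
  then have "crit_poly \<alpha> x < 0"
    using assms crit_poly_sign(2)[of \<alpha> x] T_m_pos[of \<alpha>] by simp
  then show "\<exists>y. (gain \<alpha> has_real_derivative y) (at x) \<and> y < 0"
    by (intro exI[of _ "crit_poly \<alpha> x * exp x"] conjI gain_has_real_derivative mult_neg_pos) auto
qed

lemma gain_less_gain_T_m:
  assumes "\<alpha> > 0" "0 \<le> t" "t \<noteq> T_m \<alpha>"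
  shows "gain \<alpha> t < gain \<alpha> (T_m \<alpha>)"
  using assms gain_strict_increasing[of \<alpha> t "T_m \<alpha>"] gain_strict_decreasing[of \<alpha> "T_m \<alpha>" t]
  by (cases "t < T_m \<alpha>") auto

lemma gain_le_gain_T_m:
  assumes "\<alpha> > 0" "0 \<le> t"
  shows "gain \<alpha> t \<le> gain \<alpha> (T_m \<alpha>)"
  using gain_less_gain_T_m[OF assms] by (cases "t = T_m \<alpha>") auto

text \<open>The maximum is the reciprocal of the threshold for \<open>\<beta>\<close>, which turns
  the threshold condition into
  \<open>\<beta> * gain \<alpha> (T_m \<alpha>) \<ge> 1\<close>.\<close>

lemma gain_T_m:
  assumes "\<alpha> > 0"
  shows "gain \<alpha> (T_m \<alpha>) = 1 / ((2 / T_m \<alpha> + 1) * exp (- T_m \<alpha>))"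
  unfolding gain_def one_minus_mult_T_m[OF assms]
  using T_m_pos[OF assms] by (simp add: exp_minus field_simps)

lemma gain_pos:
  assumes "\<alpha> > 0" "T \<in> {0<..<1 / \<alpha>}"
  shows "gain \<alpha> T > 0"
  using assms by (auto simp: gain_def field_simps)

section \<open>Expressing \<open>calF\<close> and the fixed points through
  \<open>gain\<close>\<close>

lemma calF_eq_ln_gain:
  assumes "\<alpha> > 0" "\<beta> > 0" "T \<in> {0<..<1 / \<alpha>}"
  shows "calF \<alpha> \<beta> T = ln (\<beta> * gain \<alpha> T)"
proof -
  have "T > 0" "1 - \<alpha> * T > 0"
    using assms by (auto simp: field_simps)
  then show ?thesis
    using assms by (simp add: calF_def gain_def ln_mult)
qed

lemma fixed_points_iff_gain:
  "T \<in> fixed_points \<alpha> \<beta> \<longleftrightarrow> 0 < T \<and> \<beta> * gain \<alpha> T = 1"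
  by (auto simp: fixed_points_def gain_def exp_minus field_simps)

section \<open>Multiplicity of a fixed point\<close>

lemma deriv_balance:
  "deriv (\<lambda>t. \<beta> * t * (1 - \<alpha> * t) - exp (- t)) = (\<lambda>t. \<beta> * (1 - 2 * \<alpha> * t) + exp (- t))"
  for \<alpha> \<beta> :: real
  by (rule ext, rule DERIV_imp_deriv)
     (auto intro!: derivative_eq_intros simp: algebra_simps)

lemma deriv2_balance:
  "deriv (\<lambda>t. \<beta> * (1 - 2 * \<alpha> * t) + exp (- t)) = (\<lambda>t. - 2 * \<alpha> * \<beta> - exp (- t))"
  for \<alpha> \<beta> :: real
  by (rule ext, rule DERIV_imp_deriv)
     (auto intro!: derivative_eq_intros simp: algebra_simps)

lemma balance_zero_order_iff:
  assumes "\<alpha> > 0" "\<beta> > 0" "T \<in> fixed_points \<alpha> \<beta>"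
  shows "has_zero_of_order (\<lambda>t. \<beta> * t * (1 - \<alpha> * t) - exp (- t)) T 1 \<longleftrightarrow> T \<noteq> T_m \<alpha>"
    and "has_zero_of_order (\<lambda>t. \<beta> * t * (1 - \<alpha> * t) - exp (- t)) T 2 \<longleftrightarrow> T = T_m \<alpha>"
proof -
  have T: "T > 0" "\<beta> * T * (1 - \<alpha> * T) = exp (- T)"
    using assms(3) by (auto simp: fixed_points_def)
  have "\<beta> * (1 - 2 * \<alpha> * T) + exp (- T) = \<beta> * crit_poly \<alpha> T"
    unfolding T(2)[symmetric] by (simp add: crit_poly_def algebra_simps power2_eq_square)
  then have d1: "\<beta> * (1 - 2 * \<alpha> * T) + exp (- T) = 0 \<longleftrightarrow> T = T_m \<alpha>"
    using assms(1,2) T(1) crit_poly_sign(3)[of \<alpha> T] by simp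
  have "0 < \<alpha> * \<beta>"
    using assms by simp
  \<comment> \<open>The second derivative is negative, which rules out zeros of order above
    two.\<close>
  then have d2: "- 2 * \<alpha> * \<beta> - exp (- T) \<noteq> 0"
    using exp_gt_zero[of "- T"] by linarith
  show "has_zero_of_order (\<lambda>t. \<beta> * t * (1 - \<alpha> * t) - exp (- t)) T 1 \<longleftrightarrow> T \<noteq> T_m \<alpha>"
    using T(2) d1 by (simp add: has_zero_of_order_def deriv_balance)
  show "has_zero_of_order (\<lambda>t. \<beta> * t * (1 - \<alpha> * t) - exp (- t)) T 2 \<longleftrightarrow> T = T_m \<alpha>"
    using T(2) d1 d2
    by (auto simp: has_zero_of_order_def numeral_2_eq_2 less_Suc_eq deriv_balance deriv2_balance)
qed

section \<open>Number of fixed points in terms of the maximum of \<open>gain\<close>\<close>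

lemma fixed_points_critical:
  assumes "\<alpha> > 0" "\<beta> > 0" "\<beta> * gain \<alpha> (T_m \<alpha>) = 1"
  shows "fixed_points \<alpha> \<beta> = {T_m \<alpha>}"
proof -
  have "\<beta> * gain \<alpha> T < 1" if "T > 0" "T \<noteq> T_m \<alpha>" for T
    using gain_less_gain_T_m[of \<alpha> T] that assms mult_strict_left_mono[of "gain \<alpha> T" _ \<beta>]
    by fastforce
  then show ?thesis
    using assms T_m_pos[OF assms(1)] by (fastforce simp: fixed_points_iff_gain)
qed

lemma fixed_points_supercritical:
  assumes "\<alpha> > 0" "\<beta> > 0" "\<beta> * gain \<alpha> (T_m \<alpha>) > 1"
  obtains T1 T2 where "T1 < T_m \<alpha>" "T_m \<alpha> < T2" "fixed_points \<alpha> \<beta> = {T1, T2}"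
proof -
  note m = T_m_pos[OF assms(1)] T_m_less_inverse[OF assms(1)]
  have gm: "1 / \<beta> \<le> gain \<alpha> (T_m \<alpha>)"
    using assms by (simp add: field_simps)
  \<comment> \<open>\<open>gain\<close> vanishes at both ends, so the intermediate value theorem
    gives one solution on each side of \<open>T_m\<close>.\<close>
  have ends: "gain \<alpha> 0 \<le> 1 / \<beta>" "gain \<alpha> (1 / \<alpha>) \<le> 1 / \<beta>"
    using assms by (simp_all add: gain_def)
  obtain T1 where T1: "0 \<le> T1" "T1 \<le> T_m \<alpha>" "gain \<alpha> T1 = 1 / \<beta>"
    using IVT'[OF ends(1) gm _ continuous_on_gain] m by auto
  obtain T2 where T2: "T_m \<alpha> \<le> T2" "gain \<alpha> T2 = 1 / \<beta>"
    using IVT2'[OF ends(2) gm _ continuous_on_gain] m by auto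
  have "T1 \<noteq> 0"
    using T1(3) assms by (auto simp: gain_def)
  have ne: "T1 \<noteq> T_m \<alpha>" "T2 \<noteq> T_m \<alpha>"
    using T1(3) T2(2) assms by auto
  \<comment> \<open>Strict monotonicity makes \<open>gain\<close> injective on each side of
    \<open>T_m\<close>.\<close>
  have "T = T1 \<or> T = T2" if "T > 0" "gain \<alpha> T = 1 / \<beta>" for T
  proof (cases "T \<le> T_m \<alpha>")
    case True
    then show ?thesis
      using that T1 gain_strict_increasing[of \<alpha> T T1] gain_strict_increasing[of \<alpha> T1 T] assms(1)
      by (cases T T1 rule: linorder_cases) auto
  next
    case False
    then show ?thesis
      using that T2 gain_strict_decreasing[of \<alpha> T T2] gain_strict_decreasing[of \<alpha> T2 T] assms(1)
      by (cases T T2 rule: linorder_cases) auto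
  qed
  moreover have "T1 > 0" "T2 > 0"
    using T1 T2 m \<open>T1 \<noteq> 0\<close> by simp_all
  moreover have "T \<in> fixed_points \<alpha> \<beta> \<longleftrightarrow> 0 < T \<and> gain \<alpha> T = 1 / \<beta>" for T
    using assms(2) by (auto simp: fixed_points_iff_gain field_simps)
  ultimately have "fixed_points \<alpha> \<beta> = {T1, T2}"
    using T1 T2 by blast
  moreover have "T1 < T_m \<alpha>" "T_m \<alpha> < T2"
    using T1 T2 ne by simp_all
  ultimately show thesis
    using that by blast
qed

lemma two_fixed_points_exist:
  assumes "\<alpha> > 0" "\<beta> > 0" "\<beta> * gain \<alpha> (T_m \<alpha>) \<ge> 1"
  shows "\<exists>T1 T2. two_fixed_points \<alpha> \<beta> T1 T2"
proof (cases "\<beta> * gain \<alpha> (T_m \<alpha>) = 1")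
  case True
  note fp = fixed_points_critical[OF assms(1,2) True]
  \<comment> \<open>The double zero is listed twice, so its multiset count 2 matches its
    order.\<close>
  have "two_fixed_points \<alpha> \<beta> (T_m \<alpha>) (T_m \<alpha>)"
    using balance_zero_order_iff(2)[OF assms(1,2), of "T_m \<alpha>"]
    by (simp add: two_fixed_points_def fp numeral_2_eq_2)
  then show ?thesis
    by blast
next
  case False
  then have "\<beta> * gain \<alpha> (T_m \<alpha>) > 1"
    using assms by simp
  from fixed_points_supercritical[OF assms(1,2) this] obtain T1 T2
    where fp: "T1 < T_m \<alpha>" "T_m \<alpha> < T2" "fixed_points \<alpha> \<beta> = {T1, T2}" .
  then have "two_fixed_points \<alpha> \<beta> T1 T2"
    using balance_zero_order_iff(1)[OF assms(1,2), of T1]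
      balance_zero_order_iff(1)[OF assms(1,2), of T2]
    by (simp add: two_fixed_points_def)
  then show ?thesis
    by blast
qed

lemma two_fixed_points_coincide_iff:
  assumes "\<alpha> > 0" "\<beta> > 0" "two_fixed_points \<alpha> \<beta> T1 T2"
  shows "T1 = T2 \<longleftrightarrow> \<beta> * gain \<alpha> (T_m \<alpha>) = 1"
proof
  assume eq: "T1 = T2"
  have fp: "T1 \<in> fixed_points \<alpha> \<beta>"
    using assms(3) by (simp add: two_fixed_points_def)
  \<comment> \<open>Equal entries give count 2, and a zero of order two can only be
    \<open>T_m\<close>.\<close>
  then have "has_zero_of_order (\<lambda>t. \<beta> * t * (1 - \<alpha> * t) - exp (- t)) T1 2"
    using assms(3) eq by (auto simp: two_fixed_points_def numeral_2_eq_2)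
  then have "T1 = T_m \<alpha>"
    using balance_zero_order_iff(2)[OF assms(1,2) fp] by simp
  then show "\<beta> * gain \<alpha> (T_m \<alpha>) = 1"
    using fp by (simp add: fixed_points_iff_gain)
next
  assume "\<beta> * gain \<alpha> (T_m \<alpha>) = 1"
  then have "{T1, T2} = {T_m \<alpha>}"
    using fixed_points_critical[OF assms(1,2)] assms(3) by (simp add: two_fixed_points_def)
  then show "T1 = T2"
    by blast
qed

theorem theorem4p2:
  fixes \<alpha> \<beta> :: real
  assumes "\<alpha> > 0" and "\<beta> > 0"
  shows "T_m \<alpha> \<in> {0<..<1 / \<alpha>}
      \<and> (\<forall>T \<in> {0<..<1 / \<alpha>}. calF \<alpha> \<beta> T \<le> calF \<alpha> \<beta> (T_m \<alpha>))
      \<and> calF \<alpha> \<beta> (T_m \<alpha>) = ln \<beta> - ln ((2 / T_m \<alpha> + 1) * exp (- T_m \<alpha>))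
      \<and> ((\<exists>T1 T2. two_fixed_points \<alpha> \<beta> T1 T2) \<longleftrightarrow>
           \<beta> \<ge> (2 / T_m \<alpha> + 1) * exp (- T_m \<alpha>))
      \<and> (\<forall>T1 T2. two_fixed_points \<alpha> \<beta> T1 T2 \<longrightarrow> (T1 = T2 \<longleftrightarrow> calF \<alpha> \<beta> (T_m \<alpha>) = 0))
      \<and> (\<not> \<beta> \<ge> (2 / T_m \<alpha> + 1) * exp (- T_m \<alpha>) \<longrightarrow> fixed_points \<alpha> \<beta> = {})"
proof -
  define c where "c = (2 / T_m \<alpha> + 1) * exp (- T_m \<alpha>)"
  note m = T_m_pos[OF assms(1)]
  have m_in: "T_m \<alpha> \<in> {0<..<1 / \<alpha>}"
    using m T_m_less_inverse[OF assms(1)] by simp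
  have "c > 0"
    using m by (simp add: c_def add_pos_pos)
  have gm: "gain \<alpha> (T_m \<alpha>) = 1 / c"
    using gain_T_m[OF assms(1)] by (simp add: c_def)
  have F: "calF \<alpha> \<beta> (T_m \<alpha>) = ln \<beta> - ln c"
    using calF_eq_ln_gain[OF assms m_in] assms \<open>c > 0\<close> by (simp add: gm ln_div)
  \<comment> \<open>Injectivity of \<open>ln\<close> on positive reals: both sides mean
    \<open>\<beta> = c\<close>.\<close>
  have F0: "calF \<alpha> \<beta> (T_m \<alpha>) = 0 \<longleftrightarrow> \<beta> * gain \<alpha> (T_m \<alpha>) = 1"
    using F assms \<open>c > 0\<close> by (auto simp: gm)
  have max: "calF \<alpha> \<beta> T \<le> calF \<alpha> \<beta> (T_m \<alpha>)" if "T \<in> {0<..<1 / \<alpha>}" for T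
    using calF_eq_ln_gain[OF assms that] calF_eq_ln_gain[OF assms m_in]
      gain_pos[OF assms(1) that] gain_pos[OF assms(1) m_in] gain_le_gain_T_m[of \<alpha> T] that assms
    by simp
  have c_iff: "\<beta> \<ge> c \<longleftrightarrow> \<beta> * gain \<alpha> (T_m \<alpha>) \<ge> 1"
    using \<open>c > 0\<close> by (simp add: gm field_simps)
  \<comment> \<open>A solution gives \<open>1 = \<beta> * gain \<alpha> T \<le> \<beta> * gain
    \<alpha> (T_m \<alpha>)\<close>. This yields both the necessity of the threshold and the absence
    of solutions below it.\<close>
  have ge: "\<beta> \<ge> c" if "T \<in> fixed_points \<alpha> \<beta>" for T
    using that gain_le_gain_T_m[of \<alpha> T] mult_left_mono[of "gain \<alpha> T" "gain \<alpha> (T_m \<alpha>)" \<beta>] assms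
    by (simp add: c_iff fixed_points_iff_gain)
  have "(\<exists>T1 T2. two_fixed_points \<alpha> \<beta> T1 T2) \<longleftrightarrow> \<beta> \<ge> c"
  proof
    assume "\<exists>T1 T2. two_fixed_points \<alpha> \<beta> T1 T2"
    then show "\<beta> \<ge> c"
      using ge by (auto simp: two_fixed_points_def)
  qed (use two_fixed_points_exist[OF assms] c_iff in blast)
  moreover have "\<not> \<beta> \<ge> c \<longrightarrow> fixed_points \<alpha> \<beta> = {}"
    using ge by blast
  ultimately show ?thesis
    using m_in max F F0 two_fixed_points_coincide_iff[OF assms] unfolding c_def by blast
qed

end
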